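(* Let $m\ge 2$, let $\mathcal{P}$ be an order-$m$, $n$-dimensional stochastic tensor, let $v\in\mathbb{R}^n$ be a stochastic vector, and let $0\le\alpha<\frac{1}{m-1}$. Then the multilinear PageRank equation $$x=\alpha\,\mathcal{P}x^{m-1}+(1-\alpha)v$$ has a unique stochastic solution $x\in\mathbb{R}^n$.
   Context: A vector is stochastic if its entries are nonnegative and sum to $1$. An order-$m$, $n$-dimensional tensor is an array with $m$ indices, each ranging over $1,\dots,n$; it is stochastic if its entries are nonnegative and, for every fixed choice of the last $m-1$ indices, the sum over the first index equals $1$. For $x\in\mathbb{R}^n$, $\mathcal{P}x^{m-1}\in\mathbb{R}^n$ is the vector with entries $[\mathcal{P}x^{m-1}]_i=\sum_{i_2,\dots,i_m}\mathcal{P}(i,i_2,\dots,i_m)\,x_{i_2}\cdots x_{i_m}$. *)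

theory Defs
  imports "HOL-Analysis.Analysis"
begin

definition stochastic_vector :: "real ^ 'n \<Rightarrow> bool" where
  "stochastic_vector x \<longleftrightarrow> (\<forall>i. 0 \<le> x $ i) \<and> (\<Sum>i\<in>UNIV. x $ i) = 1"

text \<open>
  The entry of an order-\<open>m\<close> tensor at the multi-index \<open>(i\<^sub>1, \<dots>, i\<^sub>m)\<close> is \<open>P [i\<^sub>1, \<dots>, i\<^sub>m]\<close>.
  Only lists of length \<open>m\<close> are multi-indices: the values of \<open>P\<close> on other lists are irrelevant.
  The dimension is \<open>n = CARD('n)\<close>, with \<open>'n\<close> as the index range. For \<open>m = 0\<close> the two definitions
  below are meaningless, as \<open>m - 1\<close> truncates.
\<close>

type_synonym 'n tensor = "'n list \<Rightarrow> real"

definition stochastic_tensor :: "nat \<Rightarrow> 'n::finite tensor \<Rightarrow> bool" where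
  "stochastic_tensor m P \<longleftrightarrow>
     (\<forall>js. length js = m \<longrightarrow> 0 \<le> P js) \<and>
     (\<forall>js. length js = m - 1 \<longrightarrow> (\<Sum>i\<in>UNIV. P (i # js)) = 1)"

definition tensor_apply :: "nat \<Rightarrow> 'n::finite tensor \<Rightarrow> real ^ 'n \<Rightarrow> real ^ 'n" where
  "tensor_apply m P x =
     (\<chi> i. \<Sum>js | length js = m - 1. P (i # js) * prod_list (map (\<lambda>j. x $ j) js))"

end

theory Submission
  imports Defs
begin

text \<open>
  Write \<open>\<parallel>x\<parallel>\<^sub>1\<close> for the sum of the absolute values of the entries of \<open>x\<close>. If \<open>x\<close> is stochastic, its
  monomials of degree \<open>k\<close> are the probabilities of the words of length \<open>k\<close> whose letters are drawn
  independently from \<open>x\<close>. Replacing the letters one at a time, each at a cost of at most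
  \<open>\<parallel>x - y\<parallel>\<^sub>1\<close>, shows that the word distributions of \<open>x\<close> and \<open>y\<close> differ by at most \<open>k\<parallel>x - y\<parallel>\<^sub>1\<close>
  (\<open>sum_abs_word_prob_diff_le\<close>). A stochastic tensor maps word distributions to vectors and does not
  increase the 1-norm, so the right-hand side of the PageRank equation is a self-map of the
  stochastic vectors that contracts the 1-norm by the factor \<open>\<alpha>(m - 1) < 1\<close>.

  Uniqueness is immediate. For existence, the stochastic vectors form a nonempty compact set
  (\<open>compact_stochastic_vectors\<close>), so \<open>\<parallel>x - f x\<parallel>\<^sub>1\<close> attains its minimum on it; if the minimum were
  positive, \<open>f x\<close> would have a strictly smaller displacement than the minimiser \<open>x\<close>
  (\<open>stochastic_fixed_point_unique\<close>). As compactness is a topological property, this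
  lets the contraction be measured in the 1-norm although the metric of \<open>real ^ 'n\<close> is Euclidean.
\<close>

section \<open>The 1-norm and the set of stochastic vectors\<close>

definition norm1 :: "real ^ 'n \<Rightarrow> real" where
  "norm1 x = (\<Sum>i\<in>UNIV. \<bar>x $ i\<bar>)"

lemma norm1_nonneg: "0 \<le> norm1 x"
  by (simp add: norm1_def sum_nonneg)

lemma norm1_eq_0_iff: "norm1 x = 0 \<longleftrightarrow> x = 0"
  by (simp add: norm1_def sum_nonneg_eq_0_iff vec_eq_iff)

lemma norm1_scaleR: "norm1 (c *\<^sub>R x) = \<bar>c\<bar> * norm1 x"
  by (simp add: norm1_def abs_mult sum_distrib_left)

lemma compact_stochastic_vectors: "compact {x :: real ^ 'n. stochastic_vector x}"
proof -
  have "norm x \<le> 1" if "stochastic_vector x" for x :: "real ^ 'n"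
    using norm_le_l1_cart[of x] that by (simp add: stochastic_vector_def)
  then have "bounded {x :: real ^ 'n. stochastic_vector x}"
    by (auto simp: bounded_iff)
  moreover have "closed {x :: real ^ 'n. stochastic_vector x}"
    unfolding stochastic_vector_def
    by (intro closed_Collect_conj closed_Collect_all closed_Collect_le closed_Collect_eq
        continuous_intros)
  ultimately show ?thesis
    by (simp add: compact_eq_bounded_closed)
qed

text \<open>
  The minimiser of the displacement must be a fixed point, since applying \<open>f\<close> once more would
  shrink a positive displacement. Strict contraction without a uniform factor is enough here,
  because the domain is compact.
\<close>

lemma stochastic_fixed_point_unique:
  fixes f :: "real ^ 'n \<Rightarrow> real ^ 'n" and v :: "real ^ 'n"
  assumes nonempty: "stochastic_vector v"
    and self_map: "\<And>x. stochastic_vector x \<Longrightarrow> stochastic_vector (f x)"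
    and cont: "continuous_on {x. stochastic_vector x} f"
    and shrink: "\<And>x y. stochastic_vector x \<Longrightarrow> stochastic_vector y \<Longrightarrow> x \<noteq> y
      \<Longrightarrow> norm1 (f x - f y) < norm1 (x - y)"
  shows "\<exists>!x. stochastic_vector x \<and> x = f x"
proof -
  have "continuous_on {x. stochastic_vector x} (\<lambda>x. norm1 (x - f x))"
    unfolding norm1_def by (intro continuous_intros cont)
  then have "\<exists>x\<in>{x. stochastic_vector x}. \<forall>y\<in>{x. stochastic_vector x}.
      norm1 (x - f x) \<le> norm1 (y - f y)"
    using nonempty by (intro continuous_attains_inf compact_stochastic_vectors) auto
  then obtain x where x: "stochastic_vector x"
    and min: "\<And>y. stochastic_vector y \<Longrightarrow> norm1 (x - f x) \<le> norm1 (y - f y)"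
    by auto
  have "x = f x"
    using min[OF self_map[OF x]] shrink[OF x self_map[OF x]] by linarith
  moreover have "y = x" if "stochastic_vector y" "y = f y" for y
    using shrink[OF x that(1)] \<open>x = f x\<close> that(2) by (metis less_irrefl)
  ultimately show ?thesis
    using x by blast
qed

section \<open>Distributions of random words\<close>

abbreviation word_prob :: "real ^ 'n \<Rightarrow> 'n list \<Rightarrow> real" where
  "word_prob x js \<equiv> prod_list (map (\<lambda>j. x $ j) js)"

lemma finite_words: "finite {js :: 'n::finite list. length js = k}"
  using finite_lists_length_eq[of "UNIV :: 'n set" k] by simp

lemma sum_words_Suc:
  fixes g :: "'n::finite list \<Rightarrow> real"
  shows "(\<Sum>js | length js = Suc k. g js) = (\<Sum>j\<in>UNIV. \<Sum>js | length js = k. g (j # js))"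
proof -
  have "{js :: 'n list. length js = Suc k} = (\<lambda>(j, js). j # js) ` (UNIV \<times> {js. length js = k})"
    by (auto simp: length_Suc_conv image_iff)
  moreover have "inj_on (\<lambda>(j, js). j # js) (UNIV \<times> {js :: 'n list. length js = k})"
    by (auto simp: inj_on_def)
  ultimately show ?thesis
    by (simp add: sum.reindex sum.cartesian_product case_prod_unfold)
qed

lemma word_prob_nonneg:
  assumes "stochastic_vector x"
  shows "0 \<le> word_prob x js"
  using assms by (induction js) (auto simp: stochastic_vector_def)

lemma sum_word_prob:
  assumes "stochastic_vector x"
  shows "(\<Sum>js | length js = k. word_prob x js) = 1"
proof (induction k)
  case (Suc k)
  then show ?case
    using assms
    by (simp add: sum_words_Suc stochastic_vector_def flip: sum_distrib_left)
qed simp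

text \<open>
  The first letter is exchanged separately from the rest:
  \<open>x\<^sub>j X - y\<^sub>j Y = (x\<^sub>j - y\<^sub>j) X + y\<^sub>j (X - Y)\<close>, where \<open>X\<close> and \<open>Y\<close> are the probabilities of the
  remaining word. Summed over all words, the first part costs \<open>\<parallel>x - y\<parallel>\<^sub>1\<close> since the \<open>X\<close> add up
  to 1, and the second is bounded by induction since the \<open>y\<^sub>j\<close> add up to 1.
\<close>

lemma sum_abs_word_prob_diff_le:
  assumes x: "stochastic_vector x" and y: "stochastic_vector y"
  shows "(\<Sum>js | length js = k. \<bar>word_prob x js - word_prob y js\<bar>) \<le> real k * norm1 (x - y)"
proof (induction k)
  case (Suc k)
  let ?W = "{js :: 'a list. length js = k}"
  let ?X = "word_prob x" and ?Y = "word_prob y"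
  have y0: "0 \<le> y $ j" for j
    using y by (simp add: stochastic_vector_def)
  have step: "\<bar>x $ j * ?X js - y $ j * ?Y js\<bar>
      \<le> \<bar>x $ j - y $ j\<bar> * ?X js + y $ j * \<bar>?X js - ?Y js\<bar>" for j js
  proof -
    have "x $ j * ?X js - y $ j * ?Y js = (x $ j - y $ j) * ?X js + y $ j * (?X js - ?Y js)"
      by (simp add: algebra_simps)
    also have "\<bar>\<dots>\<bar> \<le> \<bar>(x $ j - y $ j) * ?X js\<bar> + \<bar>y $ j * (?X js - ?Y js)\<bar>"
      by (rule abs_triangle_ineq)
    finally show ?thesis
      using y0[of j] word_prob_nonneg[OF x, of js] by (simp add: abs_mult)
  qed
  have "(\<Sum>js | length js = Suc k. \<bar>?X js - ?Y js\<bar>)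
      = (\<Sum>j\<in>UNIV. \<Sum>js\<in>?W. \<bar>x $ j * ?X js - y $ j * ?Y js\<bar>)"
    by (simp add: sum_words_Suc)
  also have "\<dots> \<le> (\<Sum>j\<in>UNIV. \<Sum>js\<in>?W. \<bar>x $ j - y $ j\<bar> * ?X js + y $ j * \<bar>?X js - ?Y js\<bar>)"
    by (intro sum_mono step)
  also have "\<dots> = (\<Sum>j\<in>UNIV. \<bar>x $ j - y $ j\<bar>) * (\<Sum>js\<in>?W. ?X js)
      + (\<Sum>j\<in>UNIV. y $ j) * (\<Sum>js\<in>?W. \<bar>?X js - ?Y js\<bar>)"
    by (simp add: sum.distrib sum_product)
  also have "\<dots> = norm1 (x - y) + (\<Sum>js\<in>?W. \<bar>?X js - ?Y js\<bar>)"
    using y by (simp add: sum_word_prob[OF x] norm1_def stochastic_vector_def)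
  also have "\<dots> \<le> real (Suc k) * norm1 (x - y)"
    using Suc.IH by (simp add: algebra_simps)
  finally show ?case .
qed simp

section \<open>The action of a stochastic tensor\<close>

lemma continuous_on_tensor_apply: "continuous_on S (tensor_apply m P)"
proof -
  have "continuous_on S (\<lambda>x. word_prob x js)" for js
    by (induction js) (auto intro!: continuous_intros)
  then show ?thesis
    unfolding tensor_apply_def by (intro continuous_intros)
qed

lemma sum_stochastic_tensor_words:
  fixes g :: "'n::finite list \<Rightarrow> real"
  assumes "stochastic_tensor m P"
  shows "(\<Sum>i\<in>UNIV. \<Sum>js | length js = m - 1. P (i # js) * g js) = (\<Sum>js | length js = m - 1. g js)"
proof -
  have "(\<Sum>i\<in>UNIV. \<Sum>js | length js = m - 1. P (i # js) * g js)
      = (\<Sum>js | length js = m - 1. (\<Sum>i\<in>UNIV. P (i # js)) * g js)"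
    by (subst sum.swap) (simp add: sum_distrib_right)
  also have "\<dots> = (\<Sum>js | length js = m - 1. g js)"
    using assms by (intro sum.cong) (auto simp: stochastic_tensor_def)
  finally show ?thesis .
qed

lemma stochastic_vector_tensor_apply:
  assumes "m \<ge> 1" and P: "stochastic_tensor m P" and x: "stochastic_vector x"
  shows "stochastic_vector (tensor_apply m P x)"
proof -
  have "0 \<le> P (i # js)" if "length js = m - 1" for i js
    using P that \<open>m \<ge> 1\<close> by (simp add: stochastic_tensor_def)
  then have "0 \<le> tensor_apply m P x $ i" for i
    unfolding tensor_apply_def by (auto intro!: sum_nonneg mult_nonneg_nonneg word_prob_nonneg x)
  moreover have "(\<Sum>i\<in>UNIV. tensor_apply m P x $ i) = 1"
    by (simp only: tensor_apply_def vec_lambda_beta sum_stochastic_tensor_words[OF P]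
        sum_word_prob[OF x])
  ultimately show ?thesis
    by (simp add: stochastic_vector_def)
qed

text \<open>
  Averaging against the columns of \<open>P\<close>, which are probability distributions, cannot increase the
  1-norm, so the bound for words of length \<open>m - 1\<close> carries over to the images.
\<close>

lemma norm1_tensor_apply_diff_le:
  assumes "m \<ge> 1" and P: "stochastic_tensor m P"
    and x: "stochastic_vector x" and y: "stochastic_vector y"
  shows "norm1 (tensor_apply m P x - tensor_apply m P y) \<le> (real m - 1) * norm1 (x - y)"
proof -
  let ?W = "{js :: 'a list. length js = m - 1}"
  let ?d = "\<lambda>js. word_prob x js - word_prob y js"
  have P0: "0 \<le> P (i # js)" if "js \<in> ?W" for i js
    using P that \<open>m \<ge> 1\<close> by (simp add: stochastic_tensor_def)
  have "norm1 (tensor_apply m P x - tensor_apply m P y)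
      = (\<Sum>i\<in>UNIV. \<bar>\<Sum>js\<in>?W. P (i # js) * ?d js\<bar>)"
    by (simp add: norm1_def tensor_apply_def right_diff_distrib sum_subtractf)
  also have "\<dots> \<le> (\<Sum>i\<in>UNIV. \<Sum>js\<in>?W. \<bar>P (i # js) * ?d js\<bar>)"
    by (intro sum_mono sum_abs)
  also have "\<dots> = (\<Sum>i\<in>UNIV. \<Sum>js\<in>?W. P (i # js) * \<bar>?d js\<bar>)"
    by (intro sum.cong refl) (simp only: abs_mult abs_of_nonneg[OF P0])
  also have "\<dots> = (\<Sum>js\<in>?W. \<bar>?d js\<bar>)"
    by (rule sum_stochastic_tensor_words[OF P])
  also have "\<dots> \<le> real (m - 1) * norm1 (x - y)"
    by (rule sum_abs_word_prob_diff_le[OF x y])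
  finally show ?thesis
    using \<open>m \<ge> 1\<close> by (simp add: of_nat_diff)
qed

section \<open>The multilinear PageRank equation\<close>

lemma stochastic_vector_convex_combination:
  assumes "stochastic_vector x" "stochastic_vector y" "0 \<le> a" "a \<le> 1"
  shows "stochastic_vector (a *\<^sub>R x + (1 - a) *\<^sub>R y)"
  using assms
  by (simp add: stochastic_vector_def sum.distrib flip: sum_distrib_left)

theorem theorem4p3:
  fixes m :: nat and P :: "'n::finite tensor" and v :: "real ^ 'n" and \<alpha> :: real
  assumes "m \<ge> 2"
    and "stochastic_tensor m P"
    and "stochastic_vector v"
    and "0 \<le> \<alpha>" and "\<alpha> < 1 / (real m - 1)"
  shows "\<exists>!x :: real ^ 'n.
           stochastic_vector x \<and> x = \<alpha> *\<^sub>R tensor_apply m P x + (1 - \<alpha>) *\<^sub>R v"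
proof (rule stochastic_fixed_point_unique)
  have m: "m \<ge> 1"
    using assms(1) by simp
  have factor: "\<alpha> * (real m - 1) < 1"
    using assms(1,5) by (simp add: field_simps)
  have "\<alpha> * 1 \<le> \<alpha> * (real m - 1)"
    using assms(1,4) by (intro mult_left_mono) auto
  with factor have "\<alpha> \<le> 1"
    by simp
  show "stochastic_vector v"
    by fact
  show "stochastic_vector (\<alpha> *\<^sub>R tensor_apply m P x + (1 - \<alpha>) *\<^sub>R v)"
    if "stochastic_vector x" for x
    using stochastic_vector_tensor_apply[OF m assms(2) that] assms(3,4) \<open>\<alpha> \<le> 1\<close>
    by (intro stochastic_vector_convex_combination)
  show "continuous_on {x. stochastic_vector x} (\<lambda>x. \<alpha> *\<^sub>R tensor_apply m P x + (1 - \<alpha>) *\<^sub>R v)"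
    by (intro continuous_intros continuous_on_tensor_apply)
  show "norm1 (\<alpha> *\<^sub>R tensor_apply m P x + (1 - \<alpha>) *\<^sub>R v
      - (\<alpha> *\<^sub>R tensor_apply m P y + (1 - \<alpha>) *\<^sub>R v)) < norm1 (x - y)"
    if x: "stochastic_vector x" and y: "stochastic_vector y" and "x \<noteq> y" for x y
  proof -
    have "\<alpha> *\<^sub>R tensor_apply m P x + (1 - \<alpha>) *\<^sub>R v - (\<alpha> *\<^sub>R tensor_apply m P y + (1 - \<alpha>) *\<^sub>R v)
        = \<alpha> *\<^sub>R (tensor_apply m P x - tensor_apply m P y)"
      by (simp add: scaleR_diff_right)
    then have "norm1 (\<alpha> *\<^sub>R tensor_apply m P x + (1 - \<alpha>) *\<^sub>R v
        - (\<alpha> *\<^sub>R tensor_apply m P y + (1 - \<alpha>) *\<^sub>R v))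
        = \<alpha> * norm1 (tensor_apply m P x - tensor_apply m P y)"
      using assms(4) by (simp add: norm1_scaleR)
    also have "\<dots> \<le> \<alpha> * (real m - 1) * norm1 (x - y)"
      using mult_left_mono[OF norm1_tensor_apply_diff_le[OF m assms(2) x y] assms(4)]
      by (simp add: mult.assoc)
    also have "\<dots> < 1 * norm1 (x - y)"
      using factor \<open>x \<noteq> y\<close> norm1_nonneg[of "x - y"] norm1_eq_0_iff[of "x - y"]
      by (intro mult_strict_right_mono) auto
    finally show ?thesis
      by simp
  qed
qed

end
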